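(* Let $C_0,C_1,C_2,C_3>0$ with $C_3<\min\{C_0,C_1+C_2\}$, let $\beta\in[0,1]$, and let $\xi\in[0,1]$ satisfy $1-\frac{C_2}{C_3}<\xi<\frac{C_1}{C_3}$ and $\xi<\beta$. Put $$A_2=\max\{C_3-\xi C_0,\;C_3-C_1,\;(1-\beta)C_3\},\qquad A_2'=C_3-A_2=\min\{\xi C_0,\;C_1,\;\beta C_3\},$$ and consider the Poincaré map $$Fv=\max\{C_3-C_2,\min\{A_2',\,\tfrac{\xi}{1-\xi}(C_3-v)\}\}.$$ Then $F$ has one periodical point of period 1, $v^*=\xi C_3$. When $\xi>\frac12$, it has two periodical points of period 2, $$v^-=\max\{C_3-C_2,\,\tfrac{\xi}{1-\xi}A_2\}<v^*\quad\text{and}\quad v^+=\min\{A_2',\,\tfrac{\xi}{1-\xi}C_2\}>v^*.$$ When $\xi=\frac12$, with $v^-$ and $v^+$ given by the same formulas, any point $v\in[v^-,v^* )\cup(v^*,v^+]$ is a periodical point of period 2. The map has no other periodical points.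
   Context: The setting is a diverge-merge (DM) traffic network: upstream link 0, two parallel intermediate links 1 and 2, and downstream link 3. $C_a>0$ is the capacity of link $a$; $\beta$ is the merging ratio of link 1; $\xi$ is the constant proportion of vehicles choosing link 1. Here $C_3-v\in[0,C_2]$ is the out-flux of link 2, so $v\in[C_3-C_2,C_3]$, and $F$ maps this interval to itself. A point $v$ is a periodical point of period $n$ of $F$ if $F^nv=v$ and $F^kv\ne v$ for $1\le k<n$. *)

theory Defs
  imports Complex_Main
begin

text \<open>
  The least period of a point. A period is positive, and the point has to lie in the
  domain \<open>S\<close> of the self-map \<open>F\<close>, since HOL functions are total.
\<close>

definition periodical_point :: "'a set \<Rightarrow> ('a \<Rightarrow> 'a) \<Rightarrow> nat \<Rightarrow> 'a \<Rightarrow> bool" where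
  "periodical_point S F n v \<longleftrightarrow>
     v \<in> S \<and> 1 \<le> n \<and> (F ^^ n) v = v \<and> (\<forall>k. 1 \<le> k \<and> k < n \<longrightarrow> (F ^^ k) v \<noteq> v)"

text \<open>
  \<open>C0\<close>, \<open>C1\<close>, \<open>C2\<close>, \<open>C3\<close> are the link capacities, \<open>\<beta>\<close> the merging ratio of link 1 and \<open>\<xi>\<close>
  the proportion of vehicles choosing link 1. The two thresholds below are written
  $A_2$ and $A_2'$ in the source.
\<close>

definition dm_A2 :: "real \<Rightarrow> real \<Rightarrow> real \<Rightarrow> real \<Rightarrow> real \<Rightarrow> real" where
  "dm_A2 C0 C1 C3 \<beta> \<xi> = Max {C3 - \<xi> * C0, C3 - C1, (1 - \<beta>) * C3}"

definition dm_A2' :: "real \<Rightarrow> real \<Rightarrow> real \<Rightarrow> real \<Rightarrow> real \<Rightarrow> real" where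
  "dm_A2' C0 C1 C3 \<beta> \<xi> = C3 - dm_A2 C0 C1 C3 \<beta> \<xi>"

lemma dm_A2'_eq_Min: "dm_A2' C0 C1 C3 \<beta> \<xi> = Min {\<xi> * C0, C1, \<beta> * C3}"
  by (auto simp: dm_A2'_def dm_A2_def algebra_simps max_def min_def)

definition dm_poincare :: "real \<Rightarrow> real \<Rightarrow> real \<Rightarrow> real \<Rightarrow> real \<Rightarrow> real \<Rightarrow> real \<Rightarrow> real" where
  "dm_poincare C0 C1 C2 C3 \<beta> \<xi> v =
     max (C3 - C2) (min (dm_A2' C0 C1 C3 \<beta> \<xi>) (\<xi> / (1 - \<xi>) * (C3 - v)))"

lemma dm_poincare_in_domain:
  assumes "C2 > 0" "C3 > 0" "\<beta> \<le> 1"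
  shows "dm_poincare C0 C1 C2 C3 \<beta> \<xi> v \<in> {C3 - C2..C3}"
proof -
  have "\<beta> * C3 \<le> C3"
    using assms mult_right_mono[of \<beta> 1 C3] by simp
  then have "dm_A2' C0 C1 C3 \<beta> \<xi> \<le> C3"
    unfolding dm_A2'_eq_Min by (auto simp: min_def)
  then show ?thesis
    using assms(1) by (auto simp: dm_poincare_def)
qed

end

theory Submission
  imports Defs
begin

text \<open>
  \<open>F\<close> is decreasing, so \<open>F \<circ> F\<close> is increasing, and a periodical point of an increasing map on a
  chain is fixed; hence only the periods 1 and 2 occur. In terms of the distances
  \<open>p\<close>, \<open>q\<close> to the left and to the right of the fixed point \<open>\<xi> C\<^sub>3\<close>, a 2-cycle is a solution of
  \<open>q = min u (r p)\<close>, \<open>p = min l (r q)\<close>, where \<open>r = \<xi> / (1 - \<xi>)\<close> and \<open>l\<close>, \<open>u\<close> are the distances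
  from the fixed point to the two bounds at which \<open>F\<close> is clamped. This has a unique positive solution
  for \<open>r > 1\<close>, the solutions \<open>p = q \<le> min l u\<close> for \<open>r = 1\<close>, and no positive solution for \<open>r < 1\<close>.
\<close>

text \<open>In a linear order \<open>x\<close> and \<open>f x\<close> are comparable, and
  monotonicity keeps the later iterates on the far side of \<open>f x\<close>, so the orbit cannot
  come back to \<open>x\<close> unless it never left.\<close>

lemma mono_periodic_imp_fixed:
  fixes f :: "'a::linorder \<Rightarrow> 'a"
  assumes "mono f" "(f ^^ n) x = x" "n \<ge> 1"
  shows "f x = x"
proof -
  obtain m where n: "n = Suc m"
    using assms(3) by (cases n) auto
  have up: "f x \<le> (f ^^ Suc k) x" if "x \<le> f x" for k
  proof (induction k)
    case (Suc k)
    have "f x \<le> f (f x)"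
      using assms(1) that by (rule monoD)
    also have "\<dots> \<le> f ((f ^^ Suc k) x)"
      using assms(1) Suc by (rule monoD)
    finally show ?case by simp
  qed simp
  have down: "(f ^^ Suc k) x \<le> f x" if "f x \<le> x" for k
  proof (induction k)
    case (Suc k)
    have "f ((f ^^ Suc k) x) \<le> f (f x)"
      using assms(1) Suc by (rule monoD)
    also have "\<dots> \<le> f x"
      using assms(1) that by (rule monoD)
    finally show ?case by simp
  qed simp
  show ?thesis
    using up[of m] down[of m] assms(2) n by (metis linear order.antisym)
qed

lemma antimono_periodic_imp_two_periodic:
  fixes f :: "'a::linorder \<Rightarrow> 'a"
  assumes "antimono f" "(f ^^ n) x = x" "n \<ge> 1"
  shows "f (f x) = x"
proof -
  have "mono (f ^^ 2)"
    using assms(1) by (auto simp: monotone_def numeral_2_eq_2)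
  \<comment> \<open>Since \<open>2 * n\<close> is a multiple of \<open>n\<close>, no distinction by
    the parity of \<open>n\<close> arises.\<close>
  moreover have "((f ^^ 2) ^^ n) x = x"
    using assms(2) by (simp add: funpow_mult mult_2_right funpow_add mult.commute)
  ultimately have "(f ^^ 2) x = x"
    using assms(3) by (rule mono_periodic_imp_fixed)
  then show ?thesis
    by (simp add: numeral_2_eq_2)
qed

lemma periodical_point_1: "periodical_point S f 1 v \<longleftrightarrow> v \<in> S \<and> f v = v"
  by (auto simp: periodical_point_def)

lemma periodical_point_2:
  "periodical_point S f 2 v \<longleftrightarrow> v \<in> S \<and> f (f v) = v \<and> f v \<noteq> v"
proof -
  have "1 \<le> k \<and> k < 2 \<longleftrightarrow> k = 1" for k :: nat
    by auto
  then show ?thesis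
    by (simp add: periodical_point_def numeral_2_eq_2)
qed

lemma antimono_periodical_point_cases:
  fixes f :: "'a::linorder \<Rightarrow> 'a"
  assumes "antimono f" "periodical_point S f n v"
  shows "n = 1 \<or> n = 2"
proof (rule ccontr)
  assume *: "\<not> (n = 1 \<or> n = 2)"
  have "f (f v) = v"
    using assms antimono_periodic_imp_two_periodic
    unfolding periodical_point_def by blast
  then have "(f ^^ 2) v = v"
    by (simp add: numeral_2_eq_2)
  moreover have "2 < n"
    using * assms(2) by (auto simp: periodical_point_def)
  ultimately show False
    using assms(2) by (auto simp: periodical_point_def)
qed

text \<open>With no clamp active the cycle would expand by \<open>r * r > 1\<close>, so some clamp
  is active. If \<open>p\<close> is not clamped, then \<open>q = u\<close>; otherwise
  \<open>p = l\<close>, and \<open>r * q \<le> r * u\<close> leaves the minimum at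
  \<open>l\<close>.\<close>

lemma clamped_cycle_expanding:
  fixes p q l u r :: real
  assumes "r > 1" "p > 0" "q > 0" "q = min u (r * p)" "p = min l (r * q)"
  shows "p = min l (r * u)"
proof (cases "p < l")
  case True
  then have p: "p = r * q"
    using assms(5) by linarith
  have "q < r * q" "p < r * p"
    using assms(1-3) by simp_all
  then have "q = u"
    using p assms(4) by linarith
  then show ?thesis
    using assms(5) by simp
next
  case False
  have "r * q \<le> r * u"
    using assms(1,4) by (intro mult_left_mono) auto
  then show ?thesis
    using False assms(5) by linarith
qed

lemma clamped_cycle_contracting:
  fixes p q l u r :: real
  assumes "r < 1" "p > 0" "q > 0" "q = min u (r * p)" "p = min l (r * q)"
  shows False
proof -
  have "r * p < p" "r * q < q"
    using assms(1-3) by simp_all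
  then show False
    using assms(4,5) by linarith
qed

text \<open>Existence for the cycle equations: \<open>r * (r * u)\<close> is at least
  \<open>u\<close>, so the outer minimum absorbs it. Used also with \<open>l\<close> and
  \<open>u\<close> exchanged.\<close>

lemma clamped_cycle_solution:
  fixes l u r :: real
  assumes "r \<ge> 1" "u \<ge> 0"
  shows "min u (r * min l (r * u)) = min u (r * l)"
proof -
  have "u \<le> r * u"
    using assms mult_right_mono[of 1 r u] by simp
  also have "\<dots> \<le> r * (r * u)"
    using assms mult_right_mono[of 1 r "r * u"] by simp
  finally show ?thesis
    using assms by (simp add: min_mult_distrib_left)
qed

theorem corollary4p7:
  fixes C0 C1 C2 C3 \<beta> \<xi> :: real
  assumes "C0 > 0" "C1 > 0" "C2 > 0" "C3 > 0"
    and "C3 < min C0 (C1 + C2)"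
    and "\<beta> \<in> {0..1}" and "\<xi> \<in> {0..1}"
    and "1 - C2 / C3 < \<xi>" and "\<xi> < C1 / C3" and "\<xi> < \<beta>"
  defines "A2 \<equiv> dm_A2 C0 C1 C3 \<beta> \<xi>"
    and "A2' \<equiv> dm_A2' C0 C1 C3 \<beta> \<xi>"
    and "F \<equiv> dm_poincare C0 C1 C2 C3 \<beta> \<xi>"
    and "D \<equiv> {C3 - C2..C3}"
  defines "v0 \<equiv> \<xi> * C3"
    and "vm \<equiv> max (C3 - C2) (\<xi> / (1 - \<xi>) * A2)"
    and "vp \<equiv> min A2' (\<xi> / (1 - \<xi>) * C2)"
  shows "{v. periodical_point D F 1 v} = {v0}
    \<and> (\<xi> > 1/2 \<longrightarrow> {v. periodical_point D F 2 v} = {vm, vp} \<and> vm < v0 \<and> vp > v0)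
    \<and> (\<xi> = 1/2 \<longrightarrow> (\<forall>v \<in> {vm..<v0} \<union> {v0<..vp}. periodical_point D F 2 v))
    \<and> (\<forall>n v. periodical_point D F n v \<longrightarrow>
          (n = 1 \<and> v = v0)
        \<or> (n = 2 \<and> \<xi> > 1/2 \<and> v \<in> {vm, vp})
        \<or> (n = 2 \<and> \<xi> = 1/2 \<and> v \<in> {vm..<v0} \<union> {v0<..vp}))"
proof -
  define r where "r = \<xi> / (1 - \<xi>)"
  define l where "l = v0 - (C3 - C2)"
  define u where "u = A2' - v0"
  \<comment> \<open>Strictness comes from \<open>\<xi> < \<beta>\<close> and
    \<open>\<beta> \<le> 1\<close>; it makes the quotient \<open>r\<close> meaningful.\<close>
  have \<xi>: "0 \<le> \<xi>" "\<xi> < 1"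
    using assms by auto
  have r0: "r \<ge> 0" and r1: "r > 1 \<longleftrightarrow> \<xi> > 1/2" "r = 1 \<longleftrightarrow> \<xi> = 1/2"
    using \<xi> by (auto simp: r_def field_simps)
  have rv0: "r * (C3 - v0) = v0"
    using \<xi> by (simp add: r_def v0_def field_simps)
  have l: "l > 0"
    using assms(4,8) by (simp add: l_def v0_def field_simps)
  have A2': "A2' = min (\<xi> * C0) (min C1 (\<beta> * C3))"
    by (simp add: A2'_def dm_A2'_eq_Min)
  have links: "\<xi> * C3 \<le> \<xi> * C0" "\<xi> * C3 < C1" "\<xi> * C3 < \<beta> * C3"
    using assms(4-6,9,10) \<xi> mult_left_mono[of C3 C0 \<xi>]
    by (auto simp: field_simps)
  have u0: "u \<ge> 0"
    using links by (auto simp: u_def A2' v0_def)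
  \<comment> \<open>At \<open>\<xi> = 0\<close> both \<open>A2'\<close> and \<open>v0\<close>
    vanish, so there \<open>u = 0\<close>.\<close>
  have u1: "u > 0" if "\<xi> > 0"
    using that links assms(5) mult_strict_left_mono[of C3 C0 \<xi>] by (auto simp: u_def A2' v0_def)
  have F: "F v = max (v0 - l) (min (v0 + u) (v0 - r * (v - v0)))" for v
  proof -
    have "r * (C3 - v) = v0 - r * (v - v0)"
      using rv0 by (simp add: algebra_simps)
    then show ?thesis
      by (simp add: F_def dm_poincare_def l_def u_def A2'_def flip: r_def)
  qed
  have rng: "F v \<in> D" for v
    unfolding F_def D_def by (rule dm_poincare_in_domain) (use assms in auto)
  have anti: "antimono F"
  proof (rule antimonoI)
    fix x y :: real
    assume "x \<le> y"
    then have "r * (x - v0) \<le> r * (y - v0)"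
      using r0 by (intro mult_left_mono) auto
    then show "F y \<le> F x"
      by (auto simp: F)
  qed
  \<comment> \<open>Left of \<open>v0\<close> the linear branch stays at or above \<open>v0\<close>,
    so the lower clamp is inactive; the mirror image holds on the right.\<close>
  have F_low: "F v = v0 + min u (r * (v0 - v))" if "v \<le> v0" for v
  proof -
    have "r * (v0 - v) \<ge> 0"
      using r0 that by simp
    moreover have "r * (v - v0) = - (r * (v0 - v))"
      by (simp add: algebra_simps)
    ultimately show ?thesis
      using l u0 by (simp add: F)
  qed
  have F_high: "F v = v0 - min l (r * (v - v0))" if "v \<ge> v0" for v
  proof -
    have "r * (v - v0) \<ge> 0"
      using r0 that by simp
    then show ?thesis
      using l u0 by (simp add: F)
  qed
  have vm: "vm = v0 - min l (r * u)"
  proof -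
    have "A2 = C3 - v0 - u"
      by (simp add: u_def A2_def A2'_def dm_A2'_def)
    then have "r * A2 = v0 - r * u"
      using rv0 by (simp add: right_diff_distrib)
    then show ?thesis
      by (simp add: vm_def r_def[symmetric] l_def)
  qed
  have vp: "vp = v0 + min u (r * l)"
  proof -
    have "C2 = C3 - v0 + l"
      by (simp add: l_def)
    then have "r * C2 = v0 + r * l"
      using rv0 by (simp add: distrib_left)
    then show ?thesis
      by (simp add: vp_def r_def[symmetric] u_def)
  qed
  have Fv0: "F v0 = v0"
    using F_low[of v0] u0 by simp
  \<comment> \<open>A point of a cycle is a value of \<open>F\<close>, so membership in the domain
    comes for free.\<close>
  have inD: "v \<in> D" if "F (F v) = v" for v
    using rng[of "F v"] that by simp
  \<comment> \<open>Equality is excluded because \<open>v0\<close> is fixed and would never lead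
    back to \<open>v\<close>.\<close>
  have below: "F v > v0" if "F (F v) = v" "v < v0" for v
  proof -
    have "r * (v0 - v) \<ge> 0"
      using r0 that by simp
    then have "F v \<ge> v0"
      using F_low[of v] u0 that by simp
    moreover have "F v \<noteq> v0"
      using that Fv0 by auto
    ultimately show ?thesis by simp
  qed
  have above: "F v < v0" if "F (F v) = v" "v > v0" for v
  proof -
    have "r * (v - v0) \<ge> 0"
      using r0 that by simp
    then have "F v \<le> v0"
      using F_high[of v] l that by simp
    moreover have "F v \<noteq> v0"
      using that Fv0 by auto
    ultimately show ?thesis by simp
  qed
  have fix_iff: "F v = v \<longleftrightarrow> v = v0" for v
    using below[of v] above[of v] Fv0 by (cases v v0 rule: linorder_cases) auto
  have one: "periodical_point D F 1 v \<longleftrightarrow> v = v0" for v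
    unfolding periodical_point_1 fix_iff using inD[of v0] Fv0 by auto
  have two: "periodical_point D F 2 v \<longleftrightarrow> F (F v) = v \<and> v \<noteq> v0" for v
    using inD by (auto simp: periodical_point_2 fix_iff)
  \<comment> \<open>These are the premises of the clamped cycle lemmas for \<open>p = v0 - v\<close>
    and \<open>q = F v - v0\<close>.\<close>
  have cycle: "v0 - v > 0" "F v - v0 > 0" "F v - v0 = min u (r * (v0 - v))"
    "v0 - v = min l (r * (F v - v0))" if "F (F v) = v" "v < v0" for v
    using that below[OF that] F_low[of v] F_high[of "F v"] by auto
  \<comment> \<open>Reduces a cycle point on the right to its partner on the left.\<close>
  have cycle_swap: "F (F (F v)) = F v" "F v < v0" if "F (F v) = v" "v > v0" for v
    using that above[OF that] by auto
  have expanding: "F (F v) = v \<and> v \<noteq> v0 \<longleftrightarrow> v \<in> {vm, vp}" and ends: "vm < v0" "vp > v0"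
    if "\<xi> > 1/2" for v
  proof -
    have r: "r > 1" and u: "u > 0"
      using that r1 u1 by auto
    then have "r * u > 0" "r * l > 0"
      using l by simp_all
    then show ends: "vm < v0" "vp > v0"
      using l u by (auto simp: vm vp)
    have "F vm = vp" "F vp = vm"
      using F_low[of vm] F_high[of vp] ends clamped_cycle_solution[of r u l]
        clamped_cycle_solution[of r l u] r u l by (auto simp: vm vp)
    moreover have low: "v = vm \<and> F v = vp" if "F (F v) = v" "v < v0" for v
    proof -
      note c = cycle[OF that]
      show ?thesis
        \<comment> \<open>The equations are symmetric under exchanging \<open>p\<close> with
          \<open>q\<close> and \<open>l\<close> with \<open>u\<close>: the first instance locates
          \<open>v\<close>, the second \<open>F v\<close>.\<close>
        using clamped_cycle_expanding[OF r c] clamped_cycle_expanding[OF r c(2,1,4,3)]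
        by (simp add: vm vp)
    qed
    moreover have "v = vp" if "F (F v) = v" "v > v0" for v
      using low[OF cycle_swap[OF that]] that by simp
    ultimately show "F (F v) = v \<and> v \<noteq> v0 \<longleftrightarrow> v \<in> {vm, vp}"
      using ends by (metis insert_iff empty_iff linorder_neqE order.strict_implies_not_eq)
  qed
  have isometric: "F (F v) = v \<and> v \<noteq> v0 \<longleftrightarrow> v \<in> {vm..<v0} \<union> {v0<..vp}" if "\<xi> = 1/2" for v
  proof -
    have r: "r = 1"
      using that r1 by simp
    \<comment> \<open>For \<open>r = 1\<close> the cycle equations force \<open>p = q\<close>,
      bounded by both clamps; within that bound \<open>F\<close> is the reflection in
      \<open>v0\<close>.\<close>
    have bound: "v0 - min l u \<le> w \<and> F w \<le> v0 + min l u" if "F (F w) = w" "w < v0" for w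
      using cycle(3,4)[OF that] unfolding r mult_1 by (intro conjI) linarith+
    have "F (F w) = w" if "v0 - min l u \<le> w" "w < v0" for w
    proof -
      have "F w = v0 + (v0 - w)"
        using F_low[of w] that by (simp add: r)
      then show ?thesis
        using F_high[of "F w"] that by (simp add: r)
    qed
    moreover have "F (F w) = w" if "w \<le> v0 + min l u" "v0 < w" for w
    proof -
      have "F w = v0 - (w - v0)"
        using F_high[of w] that by (simp add: r)
      then show ?thesis
        using F_low[of "F w"] that by (simp add: r)
    qed
    moreover have "w \<le> v0 + min l u" if "F (F w) = w" "v0 < w" for w
      using bound[OF cycle_swap[OF that]] that by simp
    moreover have "vm = v0 - min l u" "vp = v0 + min l u"
      by (simp_all add: r vm vp min.commute)
    ultimately show ?thesis
      unfolding Un_iff atLeastLessThan_iff greaterThanAtMost_iff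
      using bound[of v] by (metis linorder_neqE order.strict_implies_not_eq)
  qed
  have contracting: "\<not> (F (F v) = v \<and> v \<noteq> v0)" if "\<xi> < 1/2" for v
  proof
    assume v: "F (F v) = v \<and> v \<noteq> v0"
    have r: "r < 1"
      using that r1 by linarith
    have low: False if "F (F w) = w" "w < v0" for w
      using clamped_cycle_contracting[OF r cycle[OF that]] .
    show False
      using v low[of v] low[of "F v"] cycle_swap[of v] by (meson linorder_neqE)
  qed
  have classification: "(n = 1 \<and> v = v0) \<or> (n = 2 \<and> \<xi> > 1/2 \<and> v \<in> {vm, vp})
      \<or> (n = 2 \<and> \<xi> = 1/2 \<and> v \<in> {vm..<v0} \<union> {v0<..vp})"
    if P: "periodical_point D F n v" for n v
    using antimono_periodical_point_cases[OF anti P]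
  proof
    assume "n = 1"
    then show ?thesis
      using P one by blast
  next
    assume n: "n = 2"
    then have "F (F v) = v \<and> v \<noteq> v0"
      using P two by blast
    then show ?thesis
      using n expanding[of v] isometric[of v] contracting[of v]
      by (cases \<xi> "1/2 :: real" rule: linorder_cases) blast+
  qed
  show ?thesis
  proof (intro conjI impI allI)
    show "{v. periodical_point D F 1 v} = {v0}"
      unfolding one by simp
    show "\<forall>v \<in> {vm..<v0} \<union> {v0<..vp}. periodical_point D F 2 v" if "\<xi> = 1/2"
      unfolding two using isometric[OF that] by blast
    show "{v. periodical_point D F 2 v} = {vm, vp}" if "\<xi> > 1/2"
      unfolding two using expanding[OF that] by blast
  qed (use ends classification in blast)+
qed

end
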